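(* Let $n\ge 2$. The QATE circuit on $n$ qubits (defined in the context) uses $\mathcal{O}(n)$ one-qubit gates and $\binom{n-1}{2}+2(n-1)$ two-qubit gates, and the operator it implements is a bi-symmetric diagonal unitary operator of size $2^n\times 2^n$, for every choice of its real phase angles.
   Context: Qubits are $q[0],\dots,q[n-1]$, with $q[0]$ the most significant bit (first tensor factor) of the computational basis index. A square matrix is bi-symmetric if it is symmetric about both its main diagonal and its anti-diagonal; a diagonal matrix $\mathrm{diag}(d_0,\dots,d_{N-1})$ is bi-symmetric iff $d_j=d_{N-1-j}$ for all $j$. The QATE circuit (quantum approximate time evolution encoding inside the quantum pyramid architecture) consists, in order, of: (1) a layer of CNOT gates with control $q[0]$ and target $q[k]$, one for each $k=1,\dots,n-1$; (2) a one-qubit phase gate $\mathrm{diag}(1,e^{i\alpha_k})$ on $q[k]$, one for each $k=1,\dots,n-1$; (3) a two-qubit controlled-phase gate $\mathrm{diag}(1,1,1,e^{i\beta_{k,l}})$ on each pair $q[k],q[l]$ with $1\le k<l\le n-1$; (4) a second layer of CNOT gates with control $q[0]$ and target $q[k]$, one for each $k=1,\dots,n-1$. The angles $\alpha_k,\beta_{k,l}$ are real. A scalar global phase may additionally be applied and is not counted as a gate. *)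

theory Defs
  imports
    Complex_Main
    "HOL-Library.Landau_Symbols"
    "Jordan_Normal_Form.Matrix"
    "Jordan_Normal_Form.Schur_Decomposition"
begin

definition bisymmetric_mat :: "'a mat \<Rightarrow> bool" where
  "bisymmetric_mat A \<longleftrightarrow> square_mat A \<and>
     (\<forall>i<dim_row A. \<forall>j<dim_row A. A $$ (i, j) = A $$ (j, i)) \<and>
     (\<forall>i<dim_row A. \<forall>j<dim_row A.
        A $$ (i, j) = A $$ (dim_row A - 1 - j, dim_row A - 1 - i))"

definition unitary_mat :: "complex mat \<Rightarrow> bool" where
  "unitary_mat A \<longleftrightarrow> square_mat A \<and>
     inverts_mat A (mat_adjoint A) \<and> inverts_mat (mat_adjoint A) A"

text \<open>
  A gate is a small matrix together with the qubits it acts on. In \<open>Gate2 k l U\<close> the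
  4x4 matrix \<open>U\<close> is written in the basis 00, 01, 10, 11, with \<open>q[k]\<close> as the first
  (more significant) and \<open>q[l]\<close> as the second bit.
\<close>

datatype gate = Gate1 nat "complex mat" | Gate2 nat nat "complex mat"

text \<open>
  The value of \<open>q[k]\<close> in the \<open>i\<close>-th computational basis state of \<open>n\<close> qubits;
  \<open>q[0]\<close> is the most significant bit of \<open>i\<close>.
\<close>

definition qubit_val :: "nat \<Rightarrow> nat \<Rightarrow> nat \<Rightarrow> nat" where
  "qubit_val n k i = i div 2 ^ (n - 1 - k) mod 2"

text \<open>
  The action of a gate on \<open>n\<close> qubits: its matrix on the qubits it touches, tensored with
  the identity on all the others.
\<close>

fun gate_mat :: "nat \<Rightarrow> gate \<Rightarrow> complex mat" where
  "gate_mat n (Gate1 k U) = mat (2 ^ n) (2 ^ n) (\<lambda>(i, j).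
     if \<forall>m<n. m \<noteq> k \<longrightarrow> qubit_val n m i = qubit_val n m j
     then U $$ (qubit_val n k i, qubit_val n k j) else 0)"
| "gate_mat n (Gate2 k l U) = mat (2 ^ n) (2 ^ n) (\<lambda>(i, j).
     if \<forall>m<n. m \<noteq> k \<and> m \<noteq> l \<longrightarrow> qubit_val n m i = qubit_val n m j
     then U $$ (2 * qubit_val n k i + qubit_val n l i, 2 * qubit_val n k j + qubit_val n l j)
     else 0)"

text \<open>A circuit lists its gates in the order of application, so later gates multiply
  from the left.\<close>

fun circuit_mat :: "nat \<Rightarrow> gate list \<Rightarrow> complex mat" where
  "circuit_mat n [] = 1\<^sub>m (2 ^ n)"
| "circuit_mat n (g # gs) = circuit_mat n gs * gate_mat n g"

fun is_one_qubit :: "gate \<Rightarrow> bool" where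
  "is_one_qubit (Gate1 k U) = True"
| "is_one_qubit (Gate2 k l U) = False"

definition one_qubit_count :: "gate list \<Rightarrow> nat" where
  "one_qubit_count gs = length (filter is_one_qubit gs)"

definition two_qubit_count :: "gate list \<Rightarrow> nat" where
  "two_qubit_count gs = length (filter (\<lambda>g. \<not> is_one_qubit g) gs)"

definition cnot_gate :: "nat \<Rightarrow> nat \<Rightarrow> gate" where
  "cnot_gate control target = Gate2 control target
     (mat_of_rows_list 4 [[1, 0, 0, 0], [0, 1, 0, 0], [0, 0, 0, 1], [0, 0, 1, 0]])"

definition phase_gate :: "nat \<Rightarrow> real \<Rightarrow> gate" where
  "phase_gate k a = Gate1 k (mat_diag 2 (\<lambda>j. if j = 1 then cis a else 1))"

definition cphase_gate :: "nat \<Rightarrow> nat \<Rightarrow> real \<Rightarrow> gate" where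
  "cphase_gate k l b = Gate2 k l (mat_diag 4 (\<lambda>j. if j = 3 then cis b else 1))"

definition cnot_layer :: "nat \<Rightarrow> gate list" where
  "cnot_layer n = map (\<lambda>k. cnot_gate 0 k) [1..<n]"

definition phase_layer :: "nat \<Rightarrow> (nat \<Rightarrow> real) \<Rightarrow> gate list" where
  "phase_layer n \<alpha> = map (\<lambda>k. phase_gate k (\<alpha> k)) [1..<n]"

definition cphase_layer :: "nat \<Rightarrow> (nat \<Rightarrow> nat \<Rightarrow> real) \<Rightarrow> gate list" where
  "cphase_layer n \<beta> =
     concat (map (\<lambda>k. map (\<lambda>l. cphase_gate k l (\<beta> k l)) [Suc k..<n]) [1..<n])"

definition qate_circuit :: "nat \<Rightarrow> (nat \<Rightarrow> real) \<Rightarrow> (nat \<Rightarrow> nat \<Rightarrow> real) \<Rightarrow> gate list" where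
  "qate_circuit n \<alpha> \<beta> = cnot_layer n @ phase_layer n \<alpha> @ cphase_layer n \<beta> @ cnot_layer n"

text \<open>
  The implemented operator, including the optional scalar global phase \<open>cis \<theta>\<close>, which is not
  a gate; \<open>\<theta> = 0\<close> means that none is applied.
\<close>

definition qate_operator ::
    "nat \<Rightarrow> real \<Rightarrow> (nat \<Rightarrow> real) \<Rightarrow> (nat \<Rightarrow> nat \<Rightarrow> real) \<Rightarrow> complex mat" where
  "qate_operator n \<theta> \<alpha> \<beta> = cis \<theta> \<cdot>\<^sub>m circuit_mat n (qate_circuit n \<alpha> \<beta>)"

end

theory Submission
  imports Defs
begin

text \<open>
  A CNOT layer permutes the computational basis: if \<open>q[0] = 1\<close>, it flips every other qubit.
  This permutation is an involution, so conjugating the diagonal operator of the middle layers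
  by it only permutes the diagonal. The middle phases do not depend on \<open>q[0]\<close>. Negating all
  qubits (\<open>j \<mapsto> 2\<^sup>n - 1 - j\<close>) before the CNOT layer amounts to negating only \<open>q[0]\<close> after it,
  hence leaves the phase unchanged, which is bi-symmetry.
\<close>

section \<open>Qubit values as bits of a basis index\<close>

lemma qubit_val_bit: "qubit_val n k i = of_bool (bit i (n - 1 - k))"
  by (simp add: qubit_val_def bit_iff_odd odd_iff_mod_2_eq_one)

lemma not_bit_if_less:
  assumes "(i::nat) < 2 ^ n" "n \<le> m"
  shows "\<not> bit i m"
proof -
  have "i < 2 ^ m"
    using assms by (meson less_le_trans one_le_numeral power_increasing)
  then show ?thesis by (simp add: bit_iff_odd)
qed

lemma less_if_not_bit:
  assumes "\<And>m. n \<le> m \<Longrightarrow> \<not> bit (i::nat) m"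
  shows "i < 2 ^ n"
proof -
  have "take_bit n i = i"
    by (rule bit_eqI) (use assms not_le in \<open>auto simp: bit_take_bit_iff\<close>)
  then show ?thesis by (simp add: take_bit_nat_eq_self_iff)
qed

lemma eq_if_qubit_vals_eq:
  assumes "i < 2 ^ n" "j < 2 ^ n" "\<And>m. m < n \<Longrightarrow> qubit_val n m i = qubit_val n m j"
  shows "i = j"
proof (rule bit_eqI)
  fix m
  show "bit i m = bit j m"
  proof (cases "m < n")
    case True
    \<comment> \<open>Bit \<open>m\<close> is the value of qubit \<open>n - 1 - m\<close>: qubits
      are numbered from the top bit down.\<close>
    then show ?thesis
      using assms(3)[of "n - 1 - m"] by (simp add: qubit_val_bit of_bool_eq_iff)
  next
    case False
    then show ?thesis
      using assms(1,2) not_bit_if_less by (metis not_less)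
  qed
qed

text \<open>\<open>2 ^ n - 1\<close> is the all-ones word \<open>mask n\<close>; subtracting
  \<open>j\<close> from it never borrows, so it acts bitwise as XOR.\<close>

lemma qubit_val_complement:
  includes bit_operations_syntax
  assumes "j < 2 ^ n" "m < n"
  shows "qubit_val n m (2 ^ n - 1 - j) = 1 - qubit_val n m j"
proof -
  have "j AND (mask n XOR j) = 0"
    by (rule bit_eqI)
      (use assms(1) in \<open>auto simp: bit_simps dest: not_bit_if_less\<close>, meson not_bit_if_less not_le)
  \<comment> \<open>Summands without a common bit produce no carry.\<close>
  then have "j + (mask n XOR j) = j XOR (mask n XOR j)"
    by (rule disjunctive_add_eq_xor)
  also have "\<dots> = mask n"
    by (rule bit_eqI) (auto simp: bit_simps)
  finally have "2 ^ n - 1 - j = mask n XOR j"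
    by (simp add: mask_eq_exp_minus_1)
  then show ?thesis
    using assms(2) by (simp add: qubit_val_bit bit_simps)
qed

section \<open>CNOT layers as maps on basis indices\<close>

definition cnot_index :: "nat \<Rightarrow> nat \<Rightarrow> nat \<Rightarrow> nat" where
  "cnot_index n k j = (if qubit_val n 0 j = 1 then flip_bit (n - 1 - k) j else j)"

lemma cnot_index_less:
  assumes "j < 2 ^ n" "0 < k" "k < n"
  shows "cnot_index n k j < 2 ^ n"
  by (rule less_if_not_bit)
    (use assms not_bit_if_less in \<open>auto simp: cnot_index_def bit_simps\<close>)

lemma qubit_val_cnot_index:
  assumes "0 < k" "k < n" "m < n"
  shows "qubit_val n m (cnot_index n k j) =
    (if m = k then (qubit_val n m j + qubit_val n 0 j) mod 2 else qubit_val n m j)"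
  using assms by (auto simp: cnot_index_def qubit_val_bit bit_simps)

definition cnot_layer_index :: "nat \<Rightarrow> nat \<Rightarrow> nat" where
  "cnot_layer_index n = fold (cnot_index n) [1..<n]"

text \<open>No target is \<open>q[0]\<close>, so the control keeps its value throughout the fold; by
  distinctness each target is flipped at most once.\<close>

lemma fold_cnot_index:
  assumes "distinct ks" "set ks \<subseteq> {1..<n}" "j < 2 ^ n"
  shows "fold (cnot_index n) ks j < 2 ^ n"
    and "m < n \<Longrightarrow> qubit_val n m (fold (cnot_index n) ks j) =
      (if m \<in> set ks then (qubit_val n m j + qubit_val n 0 j) mod 2 else qubit_val n m j)"
  using assms
  by (induction ks arbitrary: j) (auto simp: qubit_val_cnot_index cnot_index_less)

lemma cnot_layer_index_less: "j < 2 ^ n \<Longrightarrow> cnot_layer_index n j < 2 ^ n"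
  by (simp add: cnot_layer_index_def fold_cnot_index)

lemma qubit_val_cnot_layer_index:
  assumes "j < 2 ^ n" "m < n"
  shows "qubit_val n m (cnot_layer_index n j) =
    (if m = 0 then qubit_val n m j else (qubit_val n m j + qubit_val n 0 j) mod 2)"
  using assms fold_cnot_index(2)[of "[1..<n]" n j m] by (simp add: cnot_layer_index_def)

text \<open>The control survives the layer, and adding it twice cancels modulo 2.\<close>

lemma cnot_layer_index_involution:
  assumes "j < 2 ^ n"
  shows "cnot_layer_index n (cnot_layer_index n j) = j"
proof (rule eq_if_qubit_vals_eq)
  fix m
  assume "m < n"
  then have "qubit_val n m (cnot_layer_index n (cnot_layer_index n j)) =
      (if m = 0 then qubit_val n m j
       else ((qubit_val n m j + qubit_val n 0 j) mod 2 + qubit_val n 0 j) mod 2)"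
    using assms by (simp add: qubit_val_cnot_layer_index cnot_layer_index_less)
  then show "qubit_val n m (cnot_layer_index n (cnot_layer_index n j)) = qubit_val n m j"
    by (simp add: qubit_val_bit)
qed (simp_all add: assms cnot_layer_index_less)

section \<open>Index maps as matrices\<close>

definition perm_mat :: "nat \<Rightarrow> (nat \<Rightarrow> nat) \<Rightarrow> complex mat" where
  "perm_mat N f = mat N N (\<lambda>(i, j). if i = f j then 1 else 0)"

lemma perm_mat_carrier [simp]: "perm_mat N f \<in> carrier_mat N N"
  by (simp add: perm_mat_def)

lemma mult_perm_mat:
  assumes "A \<in> carrier_mat N N" "\<And>j. j < N \<Longrightarrow> f j < N"
  shows "A * perm_mat N f = mat N N (\<lambda>(i, j). A $$ (i, f j))"
  by (rule eq_matI)
    (use assms in \<open>auto simp: perm_mat_def scalar_prod_def if_distrib sum.delta cong: if_cong\<close>)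

text \<open>Right multiplication by \<open>perm_mat N f\<close> selects column \<open>f j\<close> of
  the product of the first two factors. Its only possibly nonzero entry is \<open>d (f j)\<close>,
  in row \<open>f (f j) = j\<close>.\<close>

lemma perm_mat_conjugate_mat_diag:
  assumes "\<And>j. j < N \<Longrightarrow> f j < N" "\<And>j. j < N \<Longrightarrow> f (f j) = j"
  shows "perm_mat N f * mat_diag N d * perm_mat N f = mat_diag N (d \<circ> f)"
proof -
  have "perm_mat N f * mat_diag N d = mat N N (\<lambda>(i, j). perm_mat N f $$ (i, j) * d j)"
    by (rule mat_diag_mult_right) simp
  then show ?thesis
    using assms by (subst mult_perm_mat) (auto simp: perm_mat_def mat_diag_def)
qed

section \<open>Matrices of circuits and of the CNOT layer\<close>

lemma gate_mat_carrier [simp]: "gate_mat n g \<in> carrier_mat (2 ^ n) (2 ^ n)"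
  by (cases g) simp_all

lemma circuit_mat_carrier [simp]: "circuit_mat n gs \<in> carrier_mat (2 ^ n) (2 ^ n)"
  by (induction gs) (auto intro!: mult_carrier_mat[of _ _ "2 ^ n"])

lemma circuit_mat_append: "circuit_mat n (gs @ hs) = circuit_mat n hs * circuit_mat n gs"
proof (induction gs)
  case Nil
  show ?case by (simp add: right_mult_one_mat[OF circuit_mat_carrier])
next
  case (Cons g gs)
  then show ?case by (simp add: assoc_mult_mat[of _ "2 ^ n" "2 ^ n" _ "2 ^ n" _ "2 ^ n"])
qed

lemma gate_mat_cnot_gate:
  assumes "0 < k" "k < n"
  shows "gate_mat n (cnot_gate 0 k) = perm_mat (2 ^ n) (cnot_index n k)"
proof (rule eq_matI)
  fix i j
  assume "i < dim_row (perm_mat (2 ^ n) (cnot_index n k))"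
    and "j < dim_col (perm_mat (2 ^ n) (cnot_index n k))"
  then have ij: "i < 2 ^ n" "j < 2 ^ n" by (auto simp: perm_mat_def)
  let ?others = "\<forall>m<n. m \<noteq> 0 \<and> m \<noteq> k \<longrightarrow> qubit_val n m i = qubit_val n m j"
  \<comment> \<open>An index below \<open>2 ^ n\<close> is determined by its qubits.\<close>
  have "i = cnot_index n k j \<longleftrightarrow> (\<forall>m<n. qubit_val n m i = qubit_val n m (cnot_index n k j))"
    using ij assms cnot_index_less eq_if_qubit_vals_eq by blast
  also have "\<dots> \<longleftrightarrow> ?others \<and> qubit_val n 0 i = qubit_val n 0 j \<and>
      qubit_val n k i = (qubit_val n k j + qubit_val n 0 j) mod 2"
    using assms by (auto simp: qubit_val_cnot_index) (metis gr0I)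
  finally have "i = cnot_index n k j \<longleftrightarrow> \<dots>" .
  \<comment> \<open>If the other qubits disagree, both entries are 0; otherwise \<open>q[0]\<close>
    and \<open>q[k]\<close> select an entry of the 4x4 table.\<close>
  then show "gate_mat n (cnot_gate 0 k) $$ (i, j) = perm_mat (2 ^ n) (cnot_index n k) $$ (i, j)"
    using ij by (cases ?others)
      (auto simp: perm_mat_def cnot_gate_def mat_of_rows_list_def qubit_val_bit)
qed (simp_all add: perm_mat_def cnot_gate_def)

text \<open>\<open>fold\<close> applies the head of \<open>ks\<close> first, and
  \<open>circuit_mat\<close> puts the head gate rightmost, so both compose in the same
  order.\<close>

lemma circuit_mat_cnots:
  assumes "set ks \<subseteq> {1..<n}"
  shows "circuit_mat n (map (cnot_gate 0) ks) = perm_mat (2 ^ n) (fold (cnot_index n) ks)"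
  using assms
proof (induction ks)
  case Nil
  show ?case by (auto simp: perm_mat_def)
next
  case (Cons k ks)
  then have "circuit_mat n (map (cnot_gate 0) (k # ks)) =
      perm_mat (2 ^ n) (fold (cnot_index n) ks) * perm_mat (2 ^ n) (cnot_index n k)"
    by (simp add: gate_mat_cnot_gate)
  also have "\<dots> = mat (2 ^ n) (2 ^ n)
      (\<lambda>(i, j). perm_mat (2 ^ n) (fold (cnot_index n) ks) $$ (i, cnot_index n k j))"
    using Cons.prems by (intro mult_perm_mat) (auto simp: cnot_index_less)
  also have "\<dots> = perm_mat (2 ^ n) (fold (cnot_index n) (k # ks))"
    using Cons.prems by (auto simp: perm_mat_def cnot_index_less)
  finally show ?case .
qed

lemma circuit_mat_cnot_layer:
  "circuit_mat n (cnot_layer n) = perm_mat (2 ^ n) (cnot_layer_index n)"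
  using circuit_mat_cnots[of "[1..<n]" n] by (simp add: cnot_layer_def cnot_layer_index_def)

section \<open>Diagonal phase layers\<close>

text \<open>Unit modulus will give unitarity, and independence of \<open>q[0]\<close> bi-symmetry.
  Both conditions are closed under pointwise products.\<close>

definition tail_phases :: "nat \<Rightarrow> (nat \<Rightarrow> complex) \<Rightarrow> bool" where
  "tail_phases n d \<longleftrightarrow> (\<forall>i. cmod (d i) = 1) \<and>
     (\<forall>i j. (\<forall>m\<in>{1..<n}. qubit_val n m i = qubit_val n m j) \<longrightarrow> d i = d j)"

lemma gate_mat_phase_gate:
  assumes "k < n"
  shows "gate_mat n (phase_gate k a) =
    mat_diag (2 ^ n) (\<lambda>j. if qubit_val n k j = 1 then cis a else 1)"
proof (rule eq_matI)
  fix i j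
  assume "i < dim_row (mat_diag (2 ^ n) (\<lambda>j. if qubit_val n k j = 1 then cis a else 1))"
    and "j < dim_col (mat_diag (2 ^ n) (\<lambda>j. if qubit_val n k j = 1 then cis a else 1))"
  then have ij: "i < 2 ^ n" "j < 2 ^ n" by (auto simp: mat_diag_def)
  \<comment> \<open>A nonzero entry also needs equal values of \<open>q[k]\<close>, as the 2x2
    matrix is diagonal; then all qubits agree.\<close>
  have "i = j" if "\<forall>m<n. m \<noteq> k \<longrightarrow> qubit_val n m i = qubit_val n m j"
    "qubit_val n k i = qubit_val n k j"
    using ij that by (metis eq_if_qubit_vals_eq)
  then show "gate_mat n (phase_gate k a) $$ (i, j) =
      mat_diag (2 ^ n) (\<lambda>j. if qubit_val n k j = 1 then cis a else 1) $$ (i, j)"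
    using ij by (auto simp: phase_gate_def mat_diag_def qubit_val_bit)
qed (simp_all add: phase_gate_def mat_diag_def)

lemma gate_mat_cphase_gate:
  assumes "k < n" "l < n"
  shows "gate_mat n (cphase_gate k l b) =
    mat_diag (2 ^ n) (\<lambda>j. if qubit_val n k j = 1 \<and> qubit_val n l j = 1 then cis b else 1)"
proof (rule eq_matI)
  let ?d = "\<lambda>j. if qubit_val n k j = 1 \<and> qubit_val n l j = 1 then cis b else 1"
  fix i j
  assume "i < dim_row (mat_diag (2 ^ n) ?d)" and "j < dim_col (mat_diag (2 ^ n) ?d)"
  then have ij: "i < 2 ^ n" "j < 2 ^ n" by (auto simp: mat_diag_def)
  have "i = j" if "\<forall>m<n. m \<noteq> k \<and> m \<noteq> l \<longrightarrow> qubit_val n m i = qubit_val n m j"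
    "qubit_val n k i = qubit_val n k j" "qubit_val n l i = qubit_val n l j"
    using ij that by (metis eq_if_qubit_vals_eq)
  \<comment> \<open>The 4x4 index \<open>2 * qubit_val n k j + qubit_val n l j\<close> is 3 exactly
    when both qubits are 1.\<close>
  then show "gate_mat n (cphase_gate k l b) $$ (i, j) = mat_diag (2 ^ n) ?d $$ (i, j)"
    using ij by (auto simp: cphase_gate_def mat_diag_def qubit_val_bit)
qed (simp_all add: cphase_gate_def mat_diag_def)

lemma circuit_mat_tail_phases:
  assumes "\<forall>g\<in>set gs. \<exists>d. gate_mat n g = mat_diag (2 ^ n) d \<and> tail_phases n d"
  shows "\<exists>d. circuit_mat n gs = mat_diag (2 ^ n) d \<and> tail_phases n d"
  using assms
proof (induction gs)
  case Nil
  show ?case by (rule exI[of _ "\<lambda>_. 1"]) (simp add: tail_phases_def)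
next
  case (Cons g gs)
  then obtain d e where "gate_mat n g = mat_diag (2 ^ n) d" "tail_phases n d"
    "circuit_mat n gs = mat_diag (2 ^ n) e" "tail_phases n e"
    by auto
  then show ?case
    by (intro exI[of _ "\<lambda>j. e j * d j"])
      (auto simp: tail_phases_def norm_mult intro!: arg_cong2[where f = times])
qed

lemma circuit_mat_phase_layers:
  "\<exists>d. circuit_mat n (phase_layer n \<alpha> @ cphase_layer n \<beta>) = mat_diag (2 ^ n) d \<and> tail_phases n d"
proof (rule circuit_mat_tail_phases, rule ballI)
  fix g
  assume "g \<in> set (phase_layer n \<alpha> @ cphase_layer n \<beta>)"
  \<comment> \<open>None of these gates touches \<open>q[0]\<close>, as \<open>tail_phases\<close>
    demands.\<close>
  then consider k where "g = phase_gate k (\<alpha> k)" "k \<in> {1..<n}"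
    | k l where "g = cphase_gate k l (\<beta> k l)" "k \<in> {1..<n}" "l \<in> {1..<n}"
    by (auto simp: phase_layer_def cphase_layer_def)
  then show "\<exists>d. gate_mat n g = mat_diag (2 ^ n) d \<and> tail_phases n d"
  proof cases
    case 1
    then show ?thesis
      by (auto simp: gate_mat_phase_gate tail_phases_def
          intro!: exI[of _ "\<lambda>j. if qubit_val n k j = 1 then cis (\<alpha> k) else 1"])
  next
    case 2
    then show ?thesis
      by (auto simp: gate_mat_cphase_gate tail_phases_def intro!: exI[of _
          "\<lambda>j. if qubit_val n k j = 1 \<and> qubit_val n l j = 1 then cis (\<beta> k l) else 1"])
  qed
qed

text \<open>Complementing \<open>j\<close> only flips \<open>q[0]\<close> of \<open>cnot_layer_index n j\<close>: each other qubit
  \<open>m\<close> carries \<open>q[m] XOR q[0]\<close>, in which both bits are flipped.\<close>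

lemma tail_phases_complement:
  assumes "tail_phases n d" "j < 2 ^ n"
  shows "d (cnot_layer_index n (2 ^ n - 1 - j)) = d (cnot_layer_index n j)"
proof -
  have "2 ^ n - 1 - j < 2 ^ n" using assms(2) by linarith
  then have "qubit_val n m (cnot_layer_index n (2 ^ n - 1 - j)) =
      qubit_val n m (cnot_layer_index n j)" if "m \<in> {1..<n}" for m
  proof -
    from that have "0 < n" "m < n" "m \<noteq> 0" by auto
    have "qubit_val n m (cnot_layer_index n (2 ^ n - 1 - j)) =
        (1 - qubit_val n m j + (1 - qubit_val n 0 j)) mod 2"
      unfolding qubit_val_cnot_layer_index[OF \<open>2 ^ n - 1 - j < 2 ^ n\<close> \<open>m < n\<close>]
        qubit_val_complement[OF assms(2) \<open>m < n\<close>] qubit_val_complement[OF assms(2) \<open>0 < n\<close>]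
      using \<open>m \<noteq> 0\<close> by simp
    also have "\<dots> = (qubit_val n m j + qubit_val n 0 j) mod 2"
      by (simp add: qubit_val_bit)
    also have "\<dots> = qubit_val n m (cnot_layer_index n j)"
      using assms(2) \<open>m < n\<close> \<open>m \<noteq> 0\<close> by (simp add: qubit_val_cnot_layer_index)
    finally show ?thesis .
  qed
  then show ?thesis using assms(1) by (simp add: tail_phases_def)
qed

section \<open>Diagonal form of the QATE operator\<close>

lemma qate_operator_diag:
  obtains d where "qate_operator n \<theta> \<alpha> \<beta> = mat_diag (2 ^ n) d"
    "\<And>j. cmod (d j) = 1" "\<And>j. j < 2 ^ n \<Longrightarrow> d (2 ^ n - 1 - j) = d j"
proof -
  obtain e where e: "circuit_mat n (phase_layer n \<alpha> @ cphase_layer n \<beta>) = mat_diag (2 ^ n) e"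
    and tail: "tail_phases n e"
    using circuit_mat_phase_layers by blast
  \<comment> \<open>Both outer layers are the same involution, so this product is a
    conjugation.\<close>
  have "circuit_mat n (qate_circuit n \<alpha> \<beta>) =
      circuit_mat n (cnot_layer n) * circuit_mat n (phase_layer n \<alpha> @ cphase_layer n \<beta>)
        * circuit_mat n (cnot_layer n)"
    by (simp add: qate_circuit_def circuit_mat_append
        assoc_mult_mat[of _ "2 ^ n" "2 ^ n" _ "2 ^ n" _ "2 ^ n"])
  also have "\<dots> = mat_diag (2 ^ n) (e \<circ> cnot_layer_index n)"
    unfolding circuit_mat_cnot_layer e
    by (rule perm_mat_conjugate_mat_diag)
      (simp_all add: cnot_layer_index_less cnot_layer_index_involution)
  \<comment> \<open>The global phase is a constant of modulus 1, so the diagonal absorbs it and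
    keeps both properties.\<close>
  finally have "qate_operator n \<theta> \<alpha> \<beta> =
      mat_diag (2 ^ n) (\<lambda>j. cis \<theta> * e (cnot_layer_index n j))"
    by (auto simp: qate_operator_def mat_diag_def)
  then show thesis
    by (rule that) (use tail tail_phases_complement in
        \<open>auto simp: norm_mult tail_phases_def\<close>)
qed

section \<open>Unitarity and bi-symmetry of diagonal matrices\<close>

lemma mat_adjoint_mat_diag: "mat_adjoint (mat_diag N d) = mat_diag N (\<lambda>j. cnj (d j))"
  by (rule eq_matI) (auto simp: mat_adjoint_def mat_diag_def mat_of_rows_index)

lemma unitary_mat_diag:
  assumes "\<And>j. cmod (d j) = 1"
  shows "unitary_mat (mat_diag N d)"
proof -
  have "d j * cnj (d j) = 1" for j
    using assms[of j] by (simp add: complex_norm_square[symmetric])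
  then have "mat_diag N d * mat_adjoint (mat_diag N d) = 1\<^sub>m N"
    "mat_adjoint (mat_diag N d) * mat_diag N d = 1\<^sub>m N"
    by (simp_all add: mat_adjoint_mat_diag mult.commute)
  then show ?thesis
    by (simp add: unitary_mat_def inverts_mat_def mat_adjoint_mat_diag) (simp add: mat_diag_def)
qed

text \<open>Diagonal matrices are symmetric; reflection about the anti-diagonal sends position
  \<open>(j, j)\<close> to \<open>(N - 1 - j, N - 1 - j)\<close>.\<close>

lemma bisymmetric_mat_diag:
  assumes "\<And>j. j < N \<Longrightarrow> d (N - 1 - j) = d j"
  shows "bisymmetric_mat (mat_diag N d)"
  using assms by (auto simp: bisymmetric_mat_def mat_diag_def)

section \<open>Gate counts\<close>

lemma one_qubit_count_qate_circuit: "one_qubit_count (qate_circuit n \<alpha> \<beta>) = n - 1"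
  by (simp add: qate_circuit_def one_qubit_count_def cnot_layer_def phase_layer_def
      cphase_layer_def filter_concat comp_def cnot_gate_def phase_gate_def cphase_gate_def)

text \<open>The sum counts the pairs \<open>k < l\<close> in \<open>{1..<n}\<close> by their smaller
  element.\<close>

lemma sum_lower_eq_choose: "(\<Sum>k = 1..<n. n - Suc k) = (n - 1) choose 2"
proof -
  have "(\<Sum>k = 1..<n. n - Suc k) = (\<Sum>k<n - 1. k)"
    \<comment> \<open>Reversing the order of the summands; one formula serves as the map and its
      inverse.\<close>
    by (rule sum.reindex_bij_witness[of _ "\<lambda>k. n - 1 - k" "\<lambda>k. n - 1 - k"]) auto
  also have "(\<Sum>k<m. k) = m choose 2" for m :: nat
    by (induction m) (simp_all add: numeral_2_eq_2)
  finally show ?thesis .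
qed

lemma two_qubit_count_qate_circuit:
  "two_qubit_count (qate_circuit n \<alpha> \<beta>) = ((n - 1) choose 2) + 2 * (n - 1)"
  by (simp add: qate_circuit_def two_qubit_count_def cnot_layer_def phase_layer_def
      cphase_layer_def filter_concat comp_def cnot_gate_def phase_gate_def cphase_gate_def
      length_concat sum_lower_eq_choose[simplified] interv_sum_list_conv_sum_set_nat)

text \<open>The angles depend on \<open>n\<close>, so that the asymptotic bound speaks of an
  arbitrary family of circuits, one for each size.\<close>

theorem lemma3:
  fixes \<theta> :: "nat \<Rightarrow> real"
    and \<alpha> :: "nat \<Rightarrow> nat \<Rightarrow> real"
    and \<beta> :: "nat \<Rightarrow> nat \<Rightarrow> nat \<Rightarrow> real"
  shows "(\<lambda>n. real (one_qubit_count (qate_circuit n (\<alpha> n) (\<beta> n)))) \<in> O(\<lambda>n. real n)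
    \<and> (\<forall>n\<ge>2.
         two_qubit_count (qate_circuit n (\<alpha> n) (\<beta> n)) = ((n - 1) choose 2) + 2 * (n - 1)
       \<and> qate_operator n (\<theta> n) (\<alpha> n) (\<beta> n) \<in> carrier_mat (2 ^ n) (2 ^ n)
       \<and> diagonal_mat (qate_operator n (\<theta> n) (\<alpha> n) (\<beta> n))
       \<and> unitary_mat (qate_operator n (\<theta> n) (\<alpha> n) (\<beta> n))
       \<and> bisymmetric_mat (qate_operator n (\<theta> n) (\<alpha> n) (\<beta> n)))"
proof (intro conjI allI impI)
  show "(\<lambda>n. real (one_qubit_count (qate_circuit n (\<alpha> n) (\<beta> n)))) \<in> O(\<lambda>n. real n)"
    \<comment> \<open>The count \<open>n - 1\<close> is at most \<open>n\<close>, hence the constant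
      1.\<close>
    by (rule bigoI[of _ 1]) (simp add: one_qubit_count_qate_circuit)
next
  fix n
  let ?Q = "qate_operator n (\<theta> n) (\<alpha> n) (\<beta> n)"
  obtain d where d: "?Q = mat_diag (2 ^ n) d"
    "\<And>j. cmod (d j) = 1" "\<And>j. j < 2 ^ n \<Longrightarrow> d (2 ^ n - 1 - j) = d j"
    using qate_operator_diag[of n "\<theta> n" "\<alpha> n" "\<beta> n"] by blast
  show "?Q \<in> carrier_mat (2 ^ n) (2 ^ n)" "diagonal_mat ?Q"
    by (auto simp: d(1) mat_diag_def diagonal_mat_def)
  show "unitary_mat ?Q"
    unfolding d(1) using d(2) by (rule unitary_mat_diag)
  show "bisymmetric_mat ?Q"
    unfolding d(1) using d(3) by (rule bisymmetric_mat_diag)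
qed (rule two_qubit_count_qate_circuit)

end
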